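(* Let $1<p<\infty$, $L>0$, $a\in\mathcal{A}_p$ and $\rho\in L^1(0,L)$. Let $u$ be a nontrivial solution of $$-(a(x)|u'|^{p-2}u')'=\rho(x)|u|^{p-2}u,\qquad x\in(0,L),$$ satisfying the boundary condition $u(0)=u(L)=0$. Then $$\frac1p\left(\int_0^L a^{-\frac{1}{p-1}}(t)\,dt\right)^{1-p}\le \sup_{0\le x\le L}\left|\int_0^x\rho(t)\,dt\right|.$$
   Context: The weight $\rho$ is real-valued and allowed to change sign. The Muckenhoupt class $\mathcal{A}_p$ (in dimension one) is the set of nonnegative functions $a\in L^1_{loc}(\mathbb{R})$ for which there is a constant $c_{p,a}>0$ such that $$\left(\int_B a(x)\,dx\right)\left(\int_B a(x)^{-\frac1{p-1}}\,dx\right)^{p-1}\le c_{p,a}|B|^p$$ for every bounded interval $B\subset\mathbb{R}$ (in particular both integrals are finite, so $a>0$ almost everywhere). Solutions are understood in the usual sense for $L^1$ coefficients: $u$ and $a|u'|^{p-2}u'$ are (after modification on a null set) absolutely continuous on $[0,L]$ and the equation holds almost everywhere. *)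

theory Defs
  imports "HOL-Analysis.Analysis"
begin

text \<open>Absolute continuity of a real function on a set \<open>S\<close>, by finite families of non-overlapping
  compact intervals \<open>K = {Inf K..Sup K}\<close> contained in \<open>S\<close> (a division of its own union is
  precisely such a family).\<close>

definition abs_continuous_on :: "real set \<Rightarrow> (real \<Rightarrow> real) \<Rightarrow> bool" where
  "abs_continuous_on S f \<longleftrightarrow>
    (\<forall>\<epsilon>>0. \<exists>\<delta>>0. \<forall>\<D>. \<D> division_of \<Union>\<D> \<longrightarrow> \<Union>\<D> \<subseteq> S \<longrightarrow> (\<Sum>K\<in>\<D>. Sup K - Inf K) < \<delta> \<longrightarrow>
        (\<Sum>K\<in>\<D>. \<bar>f (Sup K) - f (Inf K)\<bar>) < \<epsilon>)"

text \<open>Positivity almost everywhere is stated explicitly because \<open>0 powr s = 0\<close>: without it the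
  integral of the negative power of \<open>a\<close> would ignore the zeros of \<open>a\<close> instead of being infinite
  when they have positive measure. Likewise the integrability conditions are needed because the
  Lebesgue integral of a non-integrable function is \<open>0\<close>.\<close>

definition muckenhoupt_class :: "real \<Rightarrow> (real \<Rightarrow> real) set" where
  "muckenhoupt_class p = {a.
     (\<forall>x. 0 \<le> a x) \<and>
     (AE x in lebesgue. 0 < a x) \<and>
     (\<forall>B. is_interval B \<longrightarrow> bounded B \<longrightarrow>
        a absolutely_integrable_on B \<and>
        (\<lambda>x. a x powr (- 1 / (p - 1))) absolutely_integrable_on B) \<and>
     (\<exists>c>0. \<forall>B. is_interval B \<longrightarrow> bounded B \<longrightarrow>
        (LINT x:B|lebesgue. a x) * (LINT x:B|lebesgue. a x powr (- 1 / (p - 1))) powr (p - 1)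
          \<le> c * measure lebesgue B powr p)}"

text \<open>The odd power \<open>\<bar>s\<bar>\<^bsup>p-2\<^esup> s\<close>, which is \<open>0\<close> at \<open>s = 0\<close> for every \<open>p\<close>.\<close>

definition odd_power :: "real \<Rightarrow> real \<Rightarrow> real" where
  "odd_power p s = \<bar>s\<bar> powr (p - 2) * s"

text \<open>Solutions of \<open>-(a \<bar>u'\<bar>\<^bsup>p-2\<^esup> u')' = \<rho> \<bar>u\<bar>\<^bsup>p-2\<^esup> u\<close> on \<open>(0,L)\<close>. Here \<open>u\<close> is the absolutely continuous
  representative of the solution and \<open>w\<close> that of the flux \<open>a \<bar>u'\<bar>\<^bsup>p-2\<^esup> u'\<close>.\<close>

definition plaplace_solution ::
  "real \<Rightarrow> real \<Rightarrow> (real \<Rightarrow> real) \<Rightarrow> (real \<Rightarrow> real) \<Rightarrow> (real \<Rightarrow> real) \<Rightarrow> bool" where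
  "plaplace_solution p L a \<rho> u \<longleftrightarrow>
     abs_continuous_on {0..L} u \<and>
     (\<exists>w. abs_continuous_on {0..L} w \<and>
        (AE x\<in>{0<..<L} in lebesgue.
           u differentiable (at x) \<and> w x = a x * odd_power p (deriv u x)) \<and>
        (AE x\<in>{0<..<L} in lebesgue.
           w differentiable (at x) \<and> - deriv w x = \<rho> x * odd_power p (u x)))"

end

theory Submission
  imports Defs
begin

text \<open>Testing the equation with \<open>u\<close> gives \<open>E = \<integral> a \<bar>u'\<bar>\<^sup>p = \<integral> \<rho> \<bar>u\<bar>\<^sup>p\<close>. With \<open>R\<close> the primitive of \<open>\<rho>\<close>, a second integration
  by parts turns the right-hand side into \<open>- \<integral> R (\<bar>u\<bar>\<^sup>p)'\<close>, which is at most \<open>p M I\<^sup>p\<close>, where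
  \<open>M = sup \<bar>R\<bar>\<close> and \<open>I = \<integral> \<bar>u'\<bar>\<close> dominates \<open>sup \<bar>u\<bar>\<close>. Jensen's inequality for \<open>s\<^sup>p\<close> and the measure
  \<open>k dx\<close> with \<open>k = a\<^bsup>-1/(p-1)\<^esup>\<close>, applied to \<open>\<bar>u'\<bar> / k\<close>, gives \<open>I\<^sup>p A\<^bsup>1-p\<^esup> \<le> E\<close> with \<open>A = \<integral> k\<close>, and \<open>I > 0\<close>
  because \<open>u\<close> is nontrivial.\<close>

section \<open>Absolute continuity under restriction and Lipschitz composition\<close>

lemma abs_continuous_onE:
  assumes "abs_continuous_on S f" "\<epsilon> > 0"
  obtains \<delta> where "\<delta> > 0" and "\<And>\<D>. \<D> division_of \<Union>\<D> \<Longrightarrow> \<Union>\<D> \<subseteq> S \<Longrightarrow>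
      (\<Sum>K\<in>\<D>. Sup K - Inf K) < \<delta> \<Longrightarrow> (\<Sum>K\<in>\<D>. \<bar>f (Sup K) - f (Inf K)\<bar>) < \<epsilon>"
  using assms(1)[unfolded abs_continuous_on_def, THEN spec, THEN mp, OF assms(2)]
proof (elim exE conjE)
  fix \<delta> :: real
  assume "\<delta> > 0" and *: "\<forall>\<D>. \<D> division_of \<Union>\<D> \<longrightarrow> \<Union>\<D> \<subseteq> S \<longrightarrow> (\<Sum>K\<in>\<D>. Sup K - Inf K) < \<delta> \<longrightarrow>
      (\<Sum>K\<in>\<D>. \<bar>f (Sup K) - f (Inf K)\<bar>) < \<epsilon>"
  show thesis by (rule that[OF \<open>\<delta> > 0\<close> *[rule_format]])
qed

lemma abs_continuous_on_subset:
  assumes "abs_continuous_on S f" "T \<subseteq> S"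
  shows "abs_continuous_on T f"
  unfolding abs_continuous_on_def
proof (intro allI impI)
  fix \<epsilon> :: real assume "\<epsilon> > 0"
  obtain \<delta> where "\<delta> > 0" and \<delta>: "\<And>\<D>. \<D> division_of \<Union>\<D> \<Longrightarrow> \<Union>\<D> \<subseteq> S \<Longrightarrow>
      (\<Sum>K\<in>\<D>. Sup K - Inf K) < \<delta> \<Longrightarrow> (\<Sum>K\<in>\<D>. \<bar>f (Sup K) - f (Inf K)\<bar>) < \<epsilon>"
    by (rule abs_continuous_onE[OF assms(1) \<open>\<epsilon> > 0\<close>]) (rule that)
  show "\<exists>\<delta>>0. \<forall>\<D>. \<D> division_of \<Union>\<D> \<longrightarrow> \<Union>\<D> \<subseteq> T \<longrightarrow> (\<Sum>K\<in>\<D>. Sup K - Inf K) < \<delta> \<longrightarrow>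
        (\<Sum>K\<in>\<D>. \<bar>f (Sup K) - f (Inf K)\<bar>) < \<epsilon>"
  proof (intro exI[of _ \<delta>] conjI allI impI \<open>\<delta> > 0\<close>)
    fix \<D> :: "real set set"
    assume D: "\<D> division_of \<Union>\<D>" "\<Union>\<D> \<subseteq> T" "(\<Sum>K\<in>\<D>. Sup K - Inf K) < \<delta>"
    show "(\<Sum>K\<in>\<D>. \<bar>f (Sup K) - f (Inf K)\<bar>) < \<epsilon>"
      by (rule \<delta>[OF D(1) subset_trans[OF D(2) \<open>T \<subseteq> S\<close>] D(3)])
  qed
qed

text \<open>Each increment grows by at most the factor \<open>C\<close>. The bound is required only
  at values of \<open>f\<close> on \<open>S\<close>, because the intended \<open>h\<close> is
  \<open>\<bar>s\<bar> powr p\<close>, which is Lipschitz on bounded sets but not globally.\<close>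

lemma abs_continuous_on_lipschitz_compose:
  assumes f: "abs_continuous_on S f"
    and lip: "\<And>x y. x \<in> S \<Longrightarrow> y \<in> S \<Longrightarrow> \<bar>h (f x) - h (f y)\<bar> \<le> C * \<bar>f x - f y\<bar>"
  shows "abs_continuous_on S (\<lambda>x. h (f x))"
  unfolding abs_continuous_on_def
proof (intro allI impI)
  fix \<epsilon> :: real assume "\<epsilon> > 0"
  \<comment> \<open>The maximum with 1 makes the constant positive, so that \<epsilon> can be
    divided by it.\<close>
  define C' where "C' = max C 1"
  have C': "C' > 0" "C \<le> C'" by (auto simp: C'_def)
  obtain \<delta> where "\<delta> > 0" and \<delta>: "\<And>\<D>. \<D> division_of \<Union>\<D> \<Longrightarrow> \<Union>\<D> \<subseteq> S \<Longrightarrow>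
      (\<Sum>K\<in>\<D>. Sup K - Inf K) < \<delta> \<Longrightarrow> (\<Sum>K\<in>\<D>. \<bar>f (Sup K) - f (Inf K)\<bar>) < \<epsilon> / C'"
    by (rule abs_continuous_onE[OF f divide_pos_pos[OF \<open>\<epsilon> > 0\<close> C'(1)]]) (rule that)
  show "\<exists>\<delta>>0. \<forall>\<D>. \<D> division_of \<Union>\<D> \<longrightarrow> \<Union>\<D> \<subseteq> S \<longrightarrow> (\<Sum>K\<in>\<D>. Sup K - Inf K) < \<delta> \<longrightarrow>
        (\<Sum>K\<in>\<D>. \<bar>h (f (Sup K)) - h (f (Inf K))\<bar>) < \<epsilon>"
  proof (intro exI[of _ \<delta>] conjI allI impI \<open>\<delta> > 0\<close>)
    fix \<D> :: "real set set"
    assume D: "\<D> division_of \<Union>\<D>" "\<Union>\<D> \<subseteq> S" "(\<Sum>K\<in>\<D>. Sup K - Inf K) < \<delta>"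
    have "(\<Sum>K\<in>\<D>. \<bar>h (f (Sup K)) - h (f (Inf K))\<bar>) \<le> (\<Sum>K\<in>\<D>. C' * \<bar>f (Sup K) - f (Inf K)\<bar>)"
    proof (rule sum_mono)
      fix K assume K: "K \<in> \<D>"
      \<comment> \<open>Members of a division are nonempty compact intervals, so both endpoints
        belong to them and hence to \<open>S\<close>.\<close>
      obtain c d where "K = cbox c d" using division_ofD(4)[OF D(1) K] by (elim exE)
      then have "Sup K \<in> K" "Inf K \<in> K" using division_ofD(3)[OF D(1) K] by auto
      with K D(2) have "Sup K \<in> S" "Inf K \<in> S" by auto
      then have "\<bar>h (f (Sup K)) - h (f (Inf K))\<bar> \<le> C * \<bar>f (Sup K) - f (Inf K)\<bar>" by (rule lip)
      also have "\<dots> \<le> C' * \<bar>f (Sup K) - f (Inf K)\<bar>" using C'(2) by (simp add: mult_right_mono)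
      finally show "\<bar>h (f (Sup K)) - h (f (Inf K))\<bar> \<le> C' * \<bar>f (Sup K) - f (Inf K)\<bar>" .
    qed
    also have "\<dots> < \<epsilon>"
      using \<delta>[OF D] C'(1) by (simp add: sum_distrib_left[symmetric] pos_less_divide_eq mult.commute)
    finally show "(\<Sum>K\<in>\<D>. \<bar>h (f (Sup K)) - h (f (Inf K))\<bar>) < \<epsilon>" .
  qed
qed

section \<open>The fundamental theorem of calculus for absolutely continuous functions\<close>

lemma negligible_outer_open:
  fixes N :: "real set"
  assumes "negligible N" "\<delta> > 0"
  obtains T where "open T" "N \<subseteq> T" "T \<in> lmeasurable" "measure lebesgue T < \<delta>"
proof -
  have N: "N \<in> null_sets lebesgue" using assms(1) by (simp only: negligible_iff_null_sets)
  obtain T where T: "open T" "N \<subseteq> T" "T - N \<in> lmeasurable" "emeasure lebesgue (T - N) < ennreal \<delta>"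
    using sets_lebesgue_outer_open[OF null_setsD2[OF N] \<open>\<delta> > 0\<close>] by metis
  have Ts: "T \<in> sets lebesgue" using T(1) by (intro sets_completionI_sets) simp
  \<comment> \<open>Removing a null set leaves the measure unchanged, so the bound for
    \<open>T - N\<close> is one for \<open>T\<close>.\<close>
  have em: "emeasure lebesgue (T - N) = emeasure lebesgue T" by (rule emeasure_Diff_null_set[OF N Ts])
  then have lt: "emeasure lebesgue T < ennreal \<delta>" using T(4) by (simp only:)
  then have Tm: "T \<in> lmeasurable" using Ts by (intro fmeasurableI) (auto intro: less_trans)
  have "measure lebesgue T < \<delta>"
    using lt \<open>\<delta> > 0\<close> unfolding emeasure_eq_measure2[OF Tm]
    by (simp add: ennreal_less_iff)
  then show thesis using that T(1,2) Tm by blast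
qed

text \<open>In the gauge integral this needs no Lebesgue theory: intervals tagged outside \<open>N\<close> are controlled by
  the derivative, those tagged in \<open>N\<close> lie in an open set of small measure, where absolute continuity
  makes the total increment of \<open>f\<close> small.\<close>

lemma abs_continuous_on_has_integral_derivative:
  fixes f g :: "real \<Rightarrow> real"
  assumes "a \<le> b" and f: "abs_continuous_on {a..b} f" and N: "negligible N"
    and der: "\<And>x. x \<in> {a..b} - N \<Longrightarrow> (f has_real_derivative g x) (at x within {a..b})"
  shows "(g has_integral (f b - f a)) {a..b}"
proof (rule has_integral_spike[OF N])
  \<comment> \<open>With the value 0 on \<open>N\<close>, terms tagged in \<open>N\<close>
    contribute nothing to the Riemann sum; only the increments of \<open>f\<close> remain
    there.\<close>
  define g0 where "g0 x = (if x \<in> N then 0 else g x)" for x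
  show "g x = g0 x" if "x \<in> {a..b} - N" for x using that by (simp add: g0_def)
  show "(g0 has_integral (f b - f a)) {a..b}"
    unfolding has_integral_real
  proof (intro allI impI)
    fix e :: real assume "e > 0"
    \<comment> \<open>Half of \<open>e\<close> is reserved for tags outside \<open>N\<close>, the
      other half for tags in \<open>N\<close>. The added 1 keeps the denominator positive when
      \<open>a = b\<close>.\<close>
    define e' where "e' = e / 2 / (b - a + 1)"
    have e': "e' > 0" "e' * (b - a) \<le> e / 2"
    proof -
      have "b - a + 1 > 0" using \<open>a \<le> b\<close> by simp
      then show "e' > 0" using \<open>e > 0\<close> by (simp add: e'_def)
      have "e' * (b - a) \<le> e' * (b - a + 1)" using \<open>e' > 0\<close> by (intro mult_left_mono) auto
      also have "\<dots> = e / 2" using \<open>b - a + 1 > 0\<close> by (simp add: e'_def del: divide_divide_eq_left)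
      finally show "e' * (b - a) \<le> e / 2" .
    qed
    obtain \<delta> where "\<delta> > 0" and \<delta>: "\<And>\<D>. \<D> division_of \<Union>\<D> \<Longrightarrow> \<Union>\<D> \<subseteq> {a..b} \<Longrightarrow>
      (\<Sum>K\<in>\<D>. Sup K - Inf K) < \<delta> \<Longrightarrow> (\<Sum>K\<in>\<D>. \<bar>f (Sup K) - f (Inf K)\<bar>) < e / 2"
      by (rule abs_continuous_onE[OF f half_gt_zero[OF \<open>e > 0\<close>]]) (rule that)
    obtain T where T: "open T" "N \<subseteq> T" and Tm: "T \<in> lmeasurable" and mT: "measure lebesgue T < \<delta>"
      using negligible_outer_open[OF N \<open>\<delta> > 0\<close>] .
    define good where "good x r \<longleftrightarrow> r > 0 \<and>
        (x \<in> {a..b} - N \<longrightarrow> (\<forall>y\<in>{a..b}. norm (y - x) < r \<longrightarrow>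
           norm (f y - f x - g x * (y - x)) \<le> e' * norm (y - x))) \<and>
        (x \<in> N \<longrightarrow> ball x r \<subseteq> T)" for x r
    have "\<exists>r. good x r" for x
    proof (cases "x \<in> N")
      case True
      then obtain r where "r > 0" "ball x r \<subseteq> T" using T openE by blast
      then show ?thesis using True unfolding good_def by blast
    next
      case False
      show ?thesis
      proof (cases "x \<in> {a..b}")
        case True
        with False have "(f has_derivative (\<lambda>h. g x * h)) (at x within {a..b})"
          using der by (simp add: has_field_derivative_def)
        then obtain r where "r > 0" "\<forall>y\<in>{a..b}. norm (y - x) < r \<longrightarrow>
             norm (f y - f x - g x * (y - x)) \<le> e' * norm (y - x)"
          using e'(1) unfolding has_derivative_within_alt by blast
        then show ?thesis using False unfolding good_def by blast
      next
        case False
        then show ?thesis using \<open>x \<notin> N\<close> unfolding good_def by (intro exI[of _ 1]) auto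
      qed
    qed
    then obtain d where good: "\<And>x. good x (d x)" by (meson)
    have d0: "d x > 0" for x using good[of x] unfolding good_def by blast
    have d: "\<bar>f y - f x - (y - x) * g0 x\<bar> \<le> e' * \<bar>y - x\<bar>"
      if "x \<in> {a..b} - N" "y \<in> {a..b}" "\<bar>y - x\<bar> < d x" for x y
    proof -
      have "\<bar>f y - f x - g x * (y - x)\<bar> \<le> e' * \<bar>y - x\<bar>"
        using good[of x] that unfolding good_def real_norm_def by blast
      moreover have "g x * (y - x) = (y - x) * g0 x" using that(1) by (simp add: g0_def)
      ultimately show ?thesis by (simp only:)
    qed
    have dN: "ball x (d x) \<subseteq> T" if "x \<in> N" for x using good[of x] that unfolding good_def by blast
    show "\<exists>\<gamma>. gauge \<gamma> \<and> (\<forall>\<D>. \<D> tagged_division_of {a..b} \<and> \<gamma> fine \<D> \<longrightarrow>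
        norm ((\<Sum>(x,k)\<in>\<D>. Henstock_Kurzweil_Integration.content k *\<^sub>R g0 x) - (f b - f a)) < e)"
    proof (intro exI[of _ "\<lambda>x. ball x (d x)"] conjI allI impI)
      show "gauge (\<lambda>x. ball x (d x))" using d0 by (rule gauge_ball_dependent[rule_format])
      fix \<D> assume "\<D> tagged_division_of {a..b} \<and> (\<lambda>x. ball x (d x)) fine \<D>"
      then have D: "\<D> tagged_division_of {a..b}" and fine: "(\<lambda>x. ball x (d x)) fine \<D>" by auto
      have fin: "finite \<D>" using D by blast
      define P where "P = {(x,K). (x,K) \<in> \<D> \<and> x \<in> N}"
      have P: "P \<subseteq> \<D>" by (auto simp: P_def)
      have Pd: "P tagged_division_of (\<Union>(snd ` P))"
        using D P unfolding tagged_division_of_def[of \<D>]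
        by (intro tagged_partial_division_of_Union_self[OF tagged_partial_division_subset]) auto
      have div: "snd ` P division_of \<Union>(snd ` P)" by (rule division_of_tagged_division[OF Pd])
      have interval: "\<exists>u v. K = {u..v} \<and> u \<le> v \<and> x \<in> K \<and> K \<subseteq> {a..b} \<and> K \<subseteq> ball x (d x)"
        if xK: "(x,K) \<in> \<D>" for x K
      proof -
        obtain u v where "K = cbox u v" using tagged_division_ofD(4)[OF D xK] by auto
        moreover have "x \<in> K" "K \<subseteq> {a..b}" using D xK by auto
        ultimately show ?thesis using fineD[OF fine xK] by auto
      qed
      have intP: "\<exists>u v. K = {u..v} \<and> u \<le> v \<and> K \<subseteq> {a..b} \<and> K \<subseteq> T" if K: "K \<in> snd ` P" for K
      proof -
        obtain x where x: "(x,K) \<in> \<D>" "x \<in> N" using K by (auto simp: P_def)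
        obtain u v where "K = {u..v}" "u \<le> v" "K \<subseteq> {a..b}" "K \<subseteq> ball x (d x)"
          using interval[OF x(1)] by auto
        with dN[OF x(2)] have "K = {u..v} \<and> u \<le> v \<and> K \<subseteq> {a..b} \<and> K \<subseteq> T" by auto
        then show ?thesis by (intro exI)
      qed
      \<comment> \<open>Absolute continuity concerns a set of intervals, \<open>P\<close> a set of
        tagged ones. An interval can carry two tags only if its interior is empty, and then its
        increment is 0; the conditional supplies the value 0 at the empty set.\<close>
      have "(\<Sum>(x,K)\<in>P. \<bar>f (Sup K) - f (Inf K)\<bar>)
          = (\<Sum>(x,K)\<in>P. if K = {} then 0 else \<bar>f (Sup K) - f (Inf K)\<bar>)"
      proof (rule sum.cong[OF refl])
        fix z assume z: "z \<in> P"
        then obtain u v where "snd z = {u..v}" "u \<le> v" using intP[of "snd z"] by auto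
        then show "(case z of (x,K) \<Rightarrow> \<bar>f (Sup K) - f (Inf K)\<bar>)
            = (case z of (x,K) \<Rightarrow> if K = {} then 0 else \<bar>f (Sup K) - f (Inf K)\<bar>)"
          by (simp add: case_prod_unfold)
      qed
      also have "\<dots> = (\<Sum>K\<in>snd ` P. if K = {} then 0 else \<bar>f (Sup K) - f (Inf K)\<bar>)"
        by (rule sum.over_tagged_division_lemma[OF Pd]) auto
      also have "\<dots> = (\<Sum>K\<in>snd ` P. \<bar>f (Sup K) - f (Inf K)\<bar>)"
      proof (rule sum.cong[OF refl])
        fix K assume "K \<in> snd ` P"
        then obtain u v where "K = {u..v}" "u \<le> v" using intP by meson
        then show "(if K = {} then 0 else \<bar>f (Sup K) - f (Inf K)\<bar>) = \<bar>f (Sup K) - f (Inf K)\<bar>" by simp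
      qed
      also have "\<dots> < e / 2"
      proof (rule \<delta>[OF div])
        show "\<Union>(snd ` P) \<subseteq> {a..b}" by (rule Union_least) (use intP in meson)
        have "(\<Sum>K\<in>snd ` P. Sup K - Inf K) = (\<Sum>K\<in>snd ` P. measure lebesgue K)"
        proof (rule sum.cong[OF refl])
          fix K assume "K \<in> snd ` P"
          then obtain u v where "K = {u..v}" "u \<le> v" using intP by meson
          then show "Sup K - Inf K = measure lebesgue K" by simp
        qed
        \<comment> \<open>The intervals do not overlap and all lie in \<open>T\<close>, so their
          total length is below \<delta>.\<close>
        also have "\<dots> = measure lebesgue (\<Union>(snd ` P))" by (rule content_division[OF div])
        also have "\<dots> \<le> measure lebesgue T"
        proof (rule measure_mono_fmeasurable)
          show "\<Union>(snd ` P) \<subseteq> T" by (rule Union_least) (use intP in meson)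
          show "\<Union>(snd ` P) \<in> sets lebesgue" by (rule fmeasurableD[OF lmeasurable_division[OF div]])
        qed (rule Tm)
        finally show "(\<Sum>K\<in>snd ` P. Sup K - Inf K) < \<delta>" using mT by simp
      qed
      finally have sumP: "(\<Sum>(x,K)\<in>P. \<bar>f (Sup K) - f (Inf K)\<bar>) < e / 2" .
      have "(\<Sum>(x,K)\<in>\<D>. Henstock_Kurzweil_Integration.content K *\<^sub>R g0 x) - (f b - f a)
          = (\<Sum>(x,K)\<in>\<D>. Henstock_Kurzweil_Integration.content K *\<^sub>R g0 x - (f (Sup K) - f (Inf K)))"
        using additive_tagged_division_1[OF \<open>a \<le> b\<close> D, of f] by (simp add: case_prod_unfold sum_subtractf)
      also have "norm \<dots> \<le> (\<Sum>(x,K)\<in>\<D>. norm (Henstock_Kurzweil_Integration.content K *\<^sub>R g0 x - (f (Sup K) - f (Inf K))))"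
        by (simp add: case_prod_unfold norm_sum)
      also have "\<dots> = (\<Sum>(x,K)\<in>P. norm (Henstock_Kurzweil_Integration.content K *\<^sub>R g0 x - (f (Sup K) - f (Inf K)))) +
          (\<Sum>(x,K)\<in>\<D> - P. norm (Henstock_Kurzweil_Integration.content K *\<^sub>R g0 x - (f (Sup K) - f (Inf K))))"
        by (metis (no_types, lifting) P add.commute fin sum.subset_diff)
      also have "(\<Sum>(x,K)\<in>P. norm (Henstock_Kurzweil_Integration.content K *\<^sub>R g0 x - (f (Sup K) - f (Inf K)))) =
          (\<Sum>(x,K)\<in>P. \<bar>f (Sup K) - f (Inf K)\<bar>)"
        by (intro sum.cong) (auto simp: P_def g0_def)
      also have "(\<Sum>(x,K)\<in>\<D> - P. norm (Henstock_Kurzweil_Integration.content K *\<^sub>R g0 x - (f (Sup K) - f (Inf K))))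
          \<le> (\<Sum>(x,K)\<in>\<D> - P. e' * (Sup K - Inf K))"
      proof (rule sum_mono, clarify)
        fix x K assume xK: "(x,K) \<in> \<D>" "(x,K) \<notin> P"
        obtain u v where uv: "K = {u..v}" "u \<le> v" "x \<in> K" "K \<subseteq> {a..b}" "K \<subseteq> ball x (d x)"
          using interval[OF xK(1)] by auto
        have x: "x \<in> {a..b} - N" using xK uv by (auto simp: P_def)
        have "u \<in> K" "v \<in> K" using uv by auto
        then have u: "u \<in> {a..b}" "\<bar>u - x\<bar> < d x" and v: "v \<in> {a..b}" "\<bar>v - x\<bar> < d x"
          using uv(4,5) by (auto simp: dist_real_def subset_iff abs_minus_commute)
        \<comment> \<open>The increment over \<open>K\<close> is split at the tag \<open>x\<close>,
          where the derivative estimate holds on both sides; the two errors add up to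
          \<open>e'\<close> times the length of \<open>K\<close>.\<close>
        have "norm (Henstock_Kurzweil_Integration.content K *\<^sub>R g0 x - (f (Sup K) - f (Inf K)))
          = \<bar>(f u - f x - (u - x) * g0 x) - (f v - f x - (v - x) * g0 x)\<bar>"
          using uv(1,2) by (simp add: algebra_simps)
        also have "\<dots> \<le> e' * \<bar>u - x\<bar> + e' * \<bar>v - x\<bar>"
          using d[OF x u] d[OF x v] by linarith
        also have "\<dots> = e' * (Sup K - Inf K)" using uv(1,2,3) by (simp add: algebra_simps)
        finally show "norm (Henstock_Kurzweil_Integration.content K *\<^sub>R g0 x - (f (Sup K) - f (Inf K))) \<le> e' * (Sup K - Inf K)" .
      qed
      also have "(\<Sum>(x,K)\<in>\<D> - P. e' * (Sup K - Inf K)) \<le> (\<Sum>(x,K)\<in>\<D>. e' * (Sup K - Inf K))"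
      proof (rule sum_mono2[OF fin], blast)
        fix z assume "z \<in> \<D> - (\<D> - P)"
        then obtain x K where z: "z = (x,K)" "(x,K) \<in> \<D>" by (cases z) auto
        then obtain u v where "K = {u..v}" "u \<le> v" using interval by blast
        then show "0 \<le> (case z of (x,K) \<Rightarrow> e' * (Sup K - Inf K))" using e'(1) z by simp
      qed
      also have "\<dots> = e' * (b - a)"
        using additive_tagged_division_1[OF \<open>a \<le> b\<close> D, of "\<lambda>x. x"]
        by (simp add: case_prod_unfold sum_distrib_left[symmetric])
      finally show "norm ((\<Sum>(x,k)\<in>\<D>. Henstock_Kurzweil_Integration.content k *\<^sub>R g0 x) - (f b - f a)) < e"
        using sumP e'(2) by linarith
    qed
  qed
qed

section \<open>Integration by parts for indefinite integrals\<close>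

lemma absolutely_integrable_continuous_mult:
  fixes f g :: "real \<Rightarrow> real"
  assumes "continuous_on {a..b} f" "g absolutely_integrable_on {a..b}"
  shows "(\<lambda>x. f x * g x) absolutely_integrable_on {a..b}"
  using assms by (intro absolutely_integrable_bounded_measurable_product_real)
    (auto intro: continuous_imp_measurable_on_sets_lebesgue compact_imp_bounded compact_continuous_image)

text \<open>Differentiability almost everywhere of an indefinite integral is avoided: the defect \<open>K\<close> of the
  product rule has increments bounded by \<open>e\<close> times those of a fixed primitive \<open>A\<close> on short intervals,
  for every \<open>e > 0\<close>, so it is constant.\<close>

lemma has_integral_product_indefinite:
  fixes f g F G :: "real \<Rightarrow> real"
  assumes "a \<le> b" and f: "f absolutely_integrable_on {a..b}" and g: "g absolutely_integrable_on {a..b}"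
    and F: "\<And>x. x \<in> {a..b} \<Longrightarrow> F x = F a + integral {a..x} f"
    and G: "\<And>x. x \<in> {a..b} \<Longrightarrow> G x = G a + integral {a..x} g"
  shows "((\<lambda>x. f x * G x + F x * g x) has_integral (F b * G b - F a * G a)) {a..b}"
proof -
  have fi: "f integrable_on {a..b}" and gi: "g integrable_on {a..b}"
    using f g by (auto intro: set_lebesgue_integral_eq_integral(1))
  have "continuous_on {a..b} (\<lambda>x. F a + integral {a..x} f)" 
    by (intro continuous_intros indefinite_integral_continuous_1 fi)
  then have contF: "continuous_on {a..b} F" by (rule continuous_on_eq) (rule F[symmetric])
  have "continuous_on {a..b} (\<lambda>x. G a + integral {a..x} g)" 
    by (intro continuous_intros indefinite_integral_continuous_1 gi)
  then have contG: "continuous_on {a..b} G" by (rule continuous_on_eq) (rule G[symmetric])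
  define h where "h x = f x * G x + F x * g x" for x
  have hi: "h integrable_on {a..b}"
    unfolding h_def using absolutely_integrable_continuous_mult[OF contF g] absolutely_integrable_continuous_mult[OF contG f]
    by (intro integrable_add) (auto simp: mult.commute intro: set_lebesgue_integral_eq_integral(1))
  define s where "s x = \<bar>f x\<bar> + \<bar>g x\<bar>" for x
  have si: "s integrable_on {a..b}"
    unfolding s_def using f g by (intro integrable_add) (auto simp: absolutely_integrable_on_def)
  define K where "K x = integral {a..x} h - F x * G x" for x
  define A where "A x = integral {a..x} s" for x
  have split: "integral {a..y} q - integral {a..x} q = integral {x..y} q"
    if "a \<le> x" "x \<le> y" "y \<le> b" "q integrable_on {a..b}" for x y and q :: "real \<Rightarrow> real"
  proof -
    have "q integrable_on {a..y}" using that by (auto intro: integrable_on_subinterval)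
    then show ?thesis using Henstock_Kurzweil_Integration.integral_combine[of a x y q] that by simp
  qed
  have small: "\<bar>K b - K a\<bar> \<le> e * (A b - A a)" if "e > 0" for e
  proof -
    obtain dF where "dF > 0" and dF: "\<And>x y. x \<in> {a..b} \<Longrightarrow> y \<in> {a..b} \<Longrightarrow> dist x y < dF \<Longrightarrow> dist (F x) (F y) < e"
      using compact_uniformly_continuous[OF contF] \<open>e > 0\<close> unfolding uniformly_continuous_on_def
      by (metis compact_Icc)
    obtain dG where "dG > 0" and dG: "\<And>x y. x \<in> {a..b} \<Longrightarrow> y \<in> {a..b} \<Longrightarrow> dist x y < dG \<Longrightarrow> dist (G x) (G y) < e"
      using compact_uniformly_continuous[OF contG] \<open>e > 0\<close> unfolding uniformly_continuous_on_def
      by (metis compact_Icc)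
    \<comment> \<open>Bisection needs a property of intervals that passes to unions of neighbours
      and holds on short intervals. The short intervals may stick out of \<open>{a..b}\<close>, so
      the premises \<open>a \<le> x\<close> and \<open>y \<le> b\<close> are built in.\<close>
    define Q where "Q x y \<longleftrightarrow> (a \<le> x \<longrightarrow> y \<le> b \<longrightarrow> \<bar>K y - K x\<bar> \<le> e * (A y - A x))" for x y
    have "Q a b"
      using \<open>a \<le> b\<close>
    proof (induction rule: Bolzano)
      case (trans x y z)
      show ?case
        unfolding Q_def
      proof (intro impI)
        assume "a \<le> x" "z \<le> b"
        with trans have "\<bar>K y - K x\<bar> \<le> e * (A y - A x)" "\<bar>K z - K y\<bar> \<le> e * (A z - A y)"
          unfolding Q_def by auto
        moreover have "e * (A y - A x) + e * (A z - A y) = e * (A z - A x)" by (simp add: algebra_simps)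
        ultimately show "\<bar>K z - K x\<bar> \<le> e * (A z - A x)" by linarith
      qed
    next
      case (local x0)
      show ?case
      proof (intro exI[of _ "min dF dG"] conjI allI impI)
        show "0 < min dF dG" using \<open>dF > 0\<close> \<open>dG > 0\<close> by simp
        fix x y assume xy: "x \<le> x0 \<and> x0 \<le> y \<and> y - x < min dF dG"
        show "Q x y"
          unfolding Q_def
        proof (intro impI)
          assume "a \<le> x" "y \<le> b"
          then have le: "a \<le> x" "x \<le> y" "y \<le> b" using xy by auto
          have sub: "{x..y} \<subseteq> {a..b}" using le by auto
          have int: "q integrable_on {x..y}" if "q integrable_on {a..b}" for q :: "real \<Rightarrow> real"
            using that sub by (rule integrable_on_subinterval)
          have xin: "x \<in> {a..b}" and yin: "y \<in> {a..b}" using le by auto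
          have FF: "F y - F x = integral {x..y} f" and GG: "G y - G x = integral {x..y} g"
            using split[OF le fi] split[OF le gi] F[OF xin] F[OF yin] G[OF xin] G[OF yin] by linarith+
          have "(f has_integral (F y - F x)) {x..y}" "(g has_integral (G y - G x)) {x..y}"
            unfolding FF GG by (intro integrable_integral int fi gi)+
          \<comment> \<open>The increment of the product is
            \<open>(F y - F x) * G y + F x * (G y - G x)\<close>. Freezing \<open>G\<close> at
            \<open>y\<close> and \<open>F\<close> at \<open>x\<close> reproduces it exactly, so the
            remaining integrand has only the small factors \<open>G t - G y\<close> and
            \<open>F t - F x\<close>.\<close>
          then have "((\<lambda>t. f t * G y + F x * g t) has_integral ((F y - F x) * G y + F x * (G y - G x))) {x..y}"
            by (intro has_integral_add has_integral_mult_left has_integral_mult_right)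
          from has_integral_diff[OF integrable_integral[OF int[OF hi]] this]
          have "((\<lambda>t. h t - (f t * G y + F x * g t)) has_integral
              (integral {x..y} h - ((F y - F x) * G y + F x * (G y - G x)))) {x..y}" .
          also have "integral {x..y} h - ((F y - F x) * G y + F x * (G y - G x)) = K y - K x"
            using split[OF le hi] by (simp add: K_def algebra_simps)
          finally have hK: "((\<lambda>t. h t - (f t * G y + F x * g t)) has_integral (K y - K x)) {x..y}" .
          then have "\<bar>K y - K x\<bar> = norm (integral {x..y} (\<lambda>t. h t - (f t * G y + F x * g t)))"
            by (simp add: integral_unique)
          also have "\<dots> \<le> integral {x..y} (\<lambda>t. e * s t)"
          proof (rule Henstock_Kurzweil_Integration.integral_norm_bound_integral)
            show "(\<lambda>t. h t - (f t * G y + F x * g t)) integrable_on {x..y}"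
              by (rule has_integral_integrable[OF hK])
            show "(\<lambda>t. e * s t) integrable_on {x..y}" by (rule has_integral_integrable[OF has_integral_mult_right[OF integrable_integral[OF int[OF si]]]])
            fix t assume t: "t \<in> {x..y}"
            have tin: "t \<in> {a..b}" using t sub by auto
            have "dist t x < dF" "dist t y < dG" using t xy by (auto simp: dist_real_def)
            then have "\<bar>F t - F x\<bar> \<le> e" "\<bar>G t - G y\<bar> \<le> e"
              using dF[OF tin xin] dG[OF tin yin] by (simp_all add: dist_real_def)
            then have "\<bar>f t\<bar> * \<bar>G t - G y\<bar> + \<bar>g t\<bar> * \<bar>F t - F x\<bar> \<le> \<bar>f t\<bar> * e + \<bar>g t\<bar> * e"
              by (intro add_mono mult_left_mono) auto
            moreover have "h t - (f t * G y + F x * g t) = f t * (G t - G y) + g t * (F t - F x)"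
              by (simp add: h_def algebra_simps)
            moreover have "\<bar>f t * (G t - G y) + g t * (F t - F x)\<bar>
                \<le> \<bar>f t\<bar> * \<bar>G t - G y\<bar> + \<bar>g t\<bar> * \<bar>F t - F x\<bar>"
              using abs_triangle_ineq[of "f t * (G t - G y)" "g t * (F t - F x)"] by (simp only: abs_mult)
            moreover have "\<bar>f t\<bar> * e + \<bar>g t\<bar> * e = e * s t" by (simp add: s_def algebra_simps)
            ultimately show "norm (h t - (f t * G y + F x * g t)) \<le> e * s t" by (simp only: real_norm_def)
          qed
          also have "\<dots> = e * (A y - A x)" using split[OF le si] by (simp add: A_def)
          finally show "\<bar>K y - K x\<bar> \<le> e * (A y - A x)" .
        qed
      qed
    qed
    then show ?thesis by (simp add: Q_def)
  qed
  have "\<bar>K b - K a\<bar> \<le> 0"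
  proof (rule field_le_epsilon)
    fix e :: real assume "e > 0"
    have "integral {a..b} s \<ge> 0"
      by (rule Henstock_Kurzweil_Integration.integral_nonneg[OF si]) (simp add: s_def)
    then have "A b - A a \<ge> 0" by (simp add: A_def)
    have A1: "A b - A a + 1 > 0" using \<open>A b - A a \<ge> 0\<close> by simp
    \<comment> \<open>The added 1 allows for a vanishing increment of \<open>A\<close>.\<close>
    have "\<bar>K b - K a\<bar> \<le> e / (A b - A a + 1) * (A b - A a)" by (rule small) (simp add: A1 \<open>e > 0\<close>)
    also have "\<dots> \<le> e" using A1 \<open>e > 0\<close> by (simp add: pos_divide_le_eq)
    finally show "\<bar>K b - K a\<bar> \<le> 0 + e" by simp
  qed
  then have "integral {a..b} h = F b * G b - F a * G a" by (simp add: K_def)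
  then show ?thesis using integrable_integral[OF hi] by (simp add: h_def[abs_def])
qed

section \<open>Calculus and convexity of powers\<close>

lemma abs_odd_power: "\<bar>odd_power p s\<bar> = \<bar>s\<bar> powr (p - 1)"
  using powr_add[of "\<bar>s\<bar>" "p - 2" 1] by (cases "s = 0") (simp_all add: odd_power_def abs_mult)

lemma odd_power_mult_self: "odd_power p s * s = \<bar>s\<bar> powr p"
proof (cases "s = 0")
  case False
  have "odd_power p s * s = \<bar>s\<bar> powr (p - 2) * (\<bar>s\<bar> powr 1 * \<bar>s\<bar> powr 1)"
    using False by (simp add: odd_power_def)
  also have "\<dots> = \<bar>s\<bar> powr p" by (simp only: powr_add[symmetric]) simp
  finally show ?thesis .
qed (simp add: odd_power_def)

text \<open>At 0 the difference quotient is \<open>odd_power p h\<close> itself, which tends to 0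
  because \<open>1 < p\<close>. Elsewhere the absolute value is locally multiplication by
  \<open>sgn s\<close>, and the chain rule applies.\<close>

lemma DERIV_abs_powr:
  assumes "1 < p"
  shows "((\<lambda>s. \<bar>s\<bar> powr p) has_real_derivative p * odd_power p s) (at s)"
proof (cases "s = 0")
  case True
  have "((\<lambda>h. \<bar>odd_power p h\<bar>) \<longlongrightarrow> \<bar>0\<bar> powr (p - 1)) (at 0)"
    unfolding abs_odd_power using assms
    by (intro tendsto_powr' tendsto_rabs tendsto_intros) auto
  then have "((\<lambda>h. odd_power p h) \<longlongrightarrow> 0) (at 0)" by (simp add: tendsto_rabs_zero_iff)
  moreover have "\<forall>\<^sub>F h in at 0. odd_power p h = (\<bar>h\<bar> powr p - 0) / h"
    using odd_power_mult_self[of p] by (auto simp: eventually_at_filter field_simps)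
  ultimately have "((\<lambda>h. (\<bar>h\<bar> powr p - 0) / h) \<longlongrightarrow> 0) (at 0)"
    by (rule Lim_transform_eventually)
  then show ?thesis using True assms by (simp add: DERIV_def odd_power_def)
next
  case False
  have "((\<lambda>x. sgn s * x) has_real_derivative sgn s) (at s)"
    by (auto intro!: derivative_eq_intros)
  then have "((\<lambda>x. \<bar>x\<bar>) has_real_derivative sgn s) (at s)"
  proof (rule has_field_derivative_transform_within_open[where S = "{x. 0 < sgn s * x}"])
    show "open {x. 0 < sgn s * x}" by (intro open_Collect_less continuous_intros)
    show "s \<in> {x. 0 < sgn s * x}" using False by (simp add: sgn_if)
    show "sgn s * x = \<bar>x\<bar>" if "x \<in> {x. 0 < sgn s * x}" for x
      using that by (auto simp: sgn_if split: if_splits)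
  qed
  then have "((\<lambda>s. \<bar>s\<bar> powr p) has_real_derivative p * \<bar>s\<bar> powr (p - 1) * sgn s) (at s)"
    using False DERIV_fun_powr[of abs "sgn s" s p] by simp
  moreover have "\<bar>s\<bar> powr (p - 1) * sgn s = odd_power p s"
    using False powr_add[of "\<bar>s\<bar>" "p - 2" 1] by (simp add: odd_power_def mult.assoc abs_mult_sgn)
  ultimately show ?thesis by (simp add: mult.assoc)
qed

text \<open>Mean value estimate on \<open>{-B..B}\<close>. It makes
  \<open>\<bar>u\<bar> powr p\<close> absolutely continuous once \<open>u\<close> is
  bounded.\<close>

lemma abs_powr_lipschitz:
  fixes p B x y :: real
  assumes "1 < p" "\<bar>x\<bar> \<le> B" "\<bar>y\<bar> \<le> B"
  shows "\<bar>\<bar>x\<bar> powr p - \<bar>y\<bar> powr p\<bar> \<le> p * B powr (p - 1) * \<bar>x - y\<bar>"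
proof -
  have "norm (\<bar>x\<bar> powr p - \<bar>y\<bar> powr p) \<le> p * B powr (p - 1) * norm (x - y)"
  proof (rule field_differentiable_bound[where S = "{-B..B}" and f' = "\<lambda>s. p * odd_power p s"])
    fix s assume "s \<in> {-B..B}"
    then have "\<bar>s\<bar> \<le> B" by auto
    then show "norm (p * odd_power p s) \<le> p * B powr (p - 1)"
      using assms(1) by (simp add: abs_mult abs_odd_power powr_mono2)
    show "((\<lambda>s. \<bar>s\<bar> powr p) has_real_derivative p * odd_power p s) (at s within {-B..B})"
      using DERIV_abs_powr[OF assms(1)] by (rule DERIV_subset) simp
  qed (use assms in auto)
  then show ?thesis by simp
qed

text \<open>Convexity on the open half-line gives the case of positive \<open>s\<close>; at
  \<open>s = 0\<close> the claim reduces to \<open>(1 - p) * t powr p \<le> 0\<close>.\<close>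

lemma powr_above_tangent:
  fixes p s t :: real
  assumes "1 < p" "0 \<le> s" "0 < t"
  shows "t powr p + p * t powr (p - 1) * (s - t) \<le> s powr p"
proof (cases "s = 0")
  case True
  have "t powr (p - 1) * t = t powr p" using assms powr_add[of t "p - 1" 1] by simp
  then have "t powr p + p * t powr (p - 1) * (s - t) = (1 - p) * t powr p"
    using True by (simp add: algebra_simps)
  also have "\<dots> \<le> 0" using assms by (intro mult_nonpos_nonneg) auto
  finally show ?thesis using True by simp
next
  case False
  have "((\<lambda>x. x powr p) has_real_derivative p * t powr (p - 1)) (at t within {0<..})"
    using has_real_derivative_powr[OF \<open>0 < t\<close>, of p] by (rule DERIV_subset) simp
  then have "s powr p - t powr p \<ge> p * t powr (p - 1) * (s - t)"
    using assms False powr_convex[of p]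
    by (intro convex_on_imp_above_tangent[where A = "{0<..}"]) (auto simp: interior_open)
  then show ?thesis by simp
qed

text \<open>The tangent at \<open>t\<close> of \<open>s\<^sup>p\<close>, taken at \<open>s = y / k\<close> and multiplied by \<open>k\<close>. Integrating it replaces Jensen's
  inequality.\<close>

lemma weighted_powr_above_tangent:
  fixes p t y \<alpha> :: real
  assumes "1 < p" "0 \<le> y" "0 < t" "0 < \<alpha>"
  defines "k \<equiv> \<alpha> powr (- 1 / (p - 1))"
  shows "t powr p * k + p * t powr (p - 1) * (y - t * k) \<le> \<alpha> * y powr p"
proof -
  have "k > 0" using assms by (simp add: k_def)
  \<comment> \<open>The exponent of the weight is chosen so that \<open>k powr (1 - p)\<close> is
    \<alpha>.\<close>
  have "k * (y / k) powr p = y powr p * (k powr 1 * k powr (- p))"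
    using \<open>k > 0\<close> \<open>0 \<le> y\<close> by (simp add: powr_divide powr_minus field_simps)
  also have "k powr 1 * k powr (- p) = k powr (1 - p)" by (simp only: powr_add[symmetric]) simp
  also have "\<dots> = \<alpha> powr (- 1 / (p - 1) * (1 - p))" by (simp only: k_def powr_powr)
  also have "- 1 / (p - 1) * (1 - p) = 1" using \<open>1 < p\<close> by (simp add: field_simps)
  finally have eq: "k * (y / k) powr p = \<alpha> * y powr p" using \<open>0 < \<alpha>\<close> by simp
  have "k * (t powr p + p * t powr (p - 1) * (y / k - t)) \<le> k * (y / k) powr p"
    using \<open>k > 0\<close> assms by (intro mult_left_mono powr_above_tangent) auto
  moreover have "k * (t powr p + p * t powr (p - 1) * (y / k - t))
      = t powr p * k + p * t powr (p - 1) * (y - t * k)"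
    using \<open>k > 0\<close> by (simp add: field_simps)
  ultimately show ?thesis unfolding eq by simp
qed

text \<open>The flux has absolute value \<open>\<alpha> * \<bar>y\<bar> powr (p - 1)\<close>; taking
  the root of order \<open>p - 1\<close> and cancelling the power of \<alpha> recovers
  \<open>\<bar>y\<bar>\<close>. This converts a bound of the flux into one of the
  derivative.\<close>

lemma abs_eq_powr_flux:
  fixes p y \<alpha> :: real
  assumes "1 < p" "0 < \<alpha>"
  shows "\<bar>y\<bar> = \<bar>\<alpha> * odd_power p y\<bar> powr (1 / (p - 1)) * \<alpha> powr (- 1 / (p - 1))"
proof -
  have "\<bar>\<alpha> * odd_power p y\<bar> powr (1 / (p - 1))
      = \<alpha> powr (1 / (p - 1)) * \<bar>y\<bar> powr ((p - 1) * (1 / (p - 1)))"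
    using assms by (simp only: abs_mult abs_odd_power powr_mult powr_powr)
  also have "\<bar>y\<bar> powr ((p - 1) * (1 / (p - 1))) = \<bar>y\<bar>" using assms by simp
  finally show ?thesis
    using assms powr_add[of \<alpha> "1 / (p - 1)" "- 1 / (p - 1)"] by (simp add: algebra_simps)
qed

text \<open>The fundamental theorem on every initial segment, the form in which integration by parts
  takes its primitives.\<close>

lemma abs_continuous_on_indefinite_integral:
  fixes f g :: "real \<Rightarrow> real"
  assumes "abs_continuous_on {a..b} f" "negligible N"
    and der: "\<And>x. x \<in> {a..b} - N \<Longrightarrow> (f has_real_derivative g x) (at x)" and x: "x \<in> {a..b}"
  shows "(g has_integral (f x - f a)) {a..x}"
proof (rule abs_continuous_on_has_integral_derivative)
  show "abs_continuous_on {a..x} f" by (rule abs_continuous_on_subset[OF assms(1)]) (use x in auto)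
  fix y assume "y \<in> {a..x} - N"
  with x have "(f has_real_derivative g y) (at y)" by (intro der) auto
  then show "(f has_real_derivative g y) (at y within {a..x})" by (rule DERIV_subset) simp
qed (use x assms in auto)

theorem theorem1p1:
  fixes p L :: real and a \<rho> u :: "real \<Rightarrow> real"
  assumes "1 < p" and "0 < L"
    and "a \<in> muckenhoupt_class p"
    and "\<rho> absolutely_integrable_on {0<..<L}"
    and "plaplace_solution p L a \<rho> u"
    and "\<exists>x\<in>{0..L}. u x \<noteq> 0"
    and "u 0 = 0" and "u L = 0"
  shows "1 / p * (LINT t:{0..L}|lebesgue. a t powr (- 1 / (p - 1))) powr (1 - p)
           \<le> (SUP x\<in>{0..L}. \<bar>LINT t:{0..x}|lebesgue. \<rho> t\<bar>)"
proof -

  \<comment> \<open>One null set for all conditions, and \<open>u\<close>, \<open>w\<close> as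
    primitives\<close>
  obtain w where ac_u: "abs_continuous_on {0..L} u" and ac_w: "abs_continuous_on {0..L} w"
    and flux: "AE x in lebesgue. x \<in> {0<..<L} \<longrightarrow> u differentiable (at x) \<and> w x = a x * odd_power p (deriv u x)"
    and eqn: "AE x in lebesgue. x \<in> {0<..<L} \<longrightarrow> w differentiable (at x) \<and> - deriv w x = \<rho> x * odd_power p (u x)"
    using assms(5) unfolding plaplace_solution_def by (elim conjE exE) (rule that)
  have a_pos: "AE x in lebesgue. 0 < a x"
    and k_int: "(\<lambda>x. a x powr (- 1 / (p - 1))) absolutely_integrable_on {0..L}"
    using assms(3) is_interval_cc[of 0 L] bounded_closed_interval[of 0 L]
    unfolding muckenhoupt_class_def by blast+
  define good where "good x \<longleftrightarrow> 0 < a x \<and> (x \<in> {0<..<L} \<longrightarrow>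
      u differentiable (at x) \<and> w x = a x * odd_power p (deriv u x) \<and>
      w differentiable (at x) \<and> - deriv w x = \<rho> x * odd_power p (u x))" for x
  have "AE x in lebesgue. good x" using flux eqn a_pos by eventually_elim (simp add: good_def)
  then obtain N0 where N0: "N0 \<in> null_sets lebesgue" "{x. \<not> good x} \<subseteq> N0"
    by (auto simp: eventually_ae_filter)
  \<comment> \<open>The endpoints join the null set because the equation is given on the open
    interval only.\<close>
  define N where "N = N0 \<union> {0, L}"
  have N: "negligible N"
    using N0(1) unfolding N_def by (intro negligible_Un) (auto simp: negligible_iff_null_sets)
  \<comment> \<open>The value 0 on \<open>N\<close> lets the later pointwise bounds of the
    derivatives hold on all of \<open>{0..L}\<close>.\<close>
  define v where "v x = (if x \<in> N then 0 else deriv u x)" for x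
  define z where "z x = (if x \<in> N then 0 else deriv w x)" for x
  define k where "k x = a x powr (- 1 / (p - 1))" for x
  have off_N: "0 < a x" "(u has_real_derivative v x) (at x)" "w x = a x * odd_power p (v x)"
    "(w has_real_derivative z x) (at x)" "- z x = \<rho> x * odd_power p (u x)"
    if x: "x \<in> {0..L} - N" for x
  proof -
    have "good x" using x N0(2) by (auto simp: N_def)
    moreover have "x \<in> {0<..<L}" using x by (auto simp: N_def)
    moreover have "v x = deriv u x" "z x = deriv w x" using x by (auto simp: v_def z_def)
    ultimately show "0 < a x" "(u has_real_derivative v x) (at x)" "w x = a x * odd_power p (v x)"
      "(w has_real_derivative z x) (at x)" "- z x = \<rho> x * odd_power p (u x)"
      unfolding good_def
      by (simp_all add: DERIV_deriv_iff_real_differentiable)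
  qed
  have v_int: "(v has_integral (u x - u 0)) {0..x}" if "x \<in> {0..L}" for x
    by (rule abs_continuous_on_indefinite_integral[OF ac_u N off_N(2) that])
  have z_int: "(z has_integral (w x - w 0)) {0..x}" if "x \<in> {0..L}" for x
    by (rule abs_continuous_on_indefinite_integral[OF ac_w N off_N(4) that])
  have L: "0 \<in> {0..L}" "L \<in> {0..L}" using \<open>0 < L\<close> by auto
  have u_eq: "u x = u 0 + integral {0..x} v" if "x \<in> {0..L}" for x
    using integral_unique[OF v_int[OF that]] by simp
  have w_eq: "w x = w 0 + integral {0..x} z" if "x \<in> {0..L}" for x
    using integral_unique[OF z_int[OF that]] by simp
  have cont_u: "continuous_on {0..L} u"
    by (rule continuous_on_eq[OF _ u_eq[symmetric]])
      (intro continuous_intros indefinite_integral_continuous_1 has_integral_integrable[OF v_int[OF L(2)]])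
  have cont_w: "continuous_on {0..L} w"
    by (rule continuous_on_eq[OF _ w_eq[symmetric]])
      (intro continuous_intros indefinite_integral_continuous_1 has_integral_integrable[OF z_int[OF L(2)]])
  have bdd: "\<exists>B\<ge>0. \<forall>x\<in>{0..L}. \<bar>f x\<bar> \<le> B" if "continuous_on {0..L} f" for f :: "real \<Rightarrow> real"
  proof -
    have "bounded (f ` {0..L})" using that by (intro compact_imp_bounded compact_continuous_image) auto
    then obtain B where "\<forall>x\<in>{0..L}. \<bar>f x\<bar> \<le> B" by (auto simp: bounded_iff)
    then show ?thesis by (intro exI[of _ "\<bar>B\<bar>"]) auto
  qed

  \<comment> \<open>Integrability of the derivative and the bound of \<open>u\<close>\<close>
  obtain W where W: "\<And>x. x \<in> {0..L} \<Longrightarrow> \<bar>w x\<bar> \<le> W" using bdd[OF cont_w] by blast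
  define C where "C = W powr (1 / (p - 1))"
  have k_nonneg: "0 \<le> k x" for x by (simp add: k_def)
  \<comment> \<open>The continuous flux is bounded, so inverting it bounds the derivative by a
    multiple of the integrable weight \<open>k\<close>. This upgrades the gauge integral of
    \<open>v\<close> to an absolute one.\<close>
  have v_le: "\<bar>v x\<bar> \<le> C * k x" if x: "x \<in> {0..L}" for x
  proof (cases "x \<in> N")
    case True
    then show ?thesis using k_nonneg[of x] by (simp add: v_def C_def)
  next
    case False
    then have x': "x \<in> {0..L} - N" using x by simp
    have "\<bar>v x\<bar> = \<bar>w x\<bar> powr (1 / (p - 1)) * k x"
      unfolding k_def off_N(3)[OF x'] by (rule abs_eq_powr_flux[OF \<open>1 < p\<close> off_N(1)[OF x']])
    also have "\<dots> \<le> C * k x"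
      unfolding C_def using W[OF x] \<open>1 < p\<close> by (intro mult_right_mono powr_mono2 k_nonneg) auto
    finally show ?thesis .
  qed
  have k_int': "k absolutely_integrable_on {0..L}" using k_int by (simp add: k_def[abs_def])
  then have k_hk: "k integrable_on {0..L}" by (rule set_lebesgue_integral_eq_integral(1))
  have dominated: "f absolutely_integrable_on {0..L}"
    if "f integrable_on {0..L}" "g integrable_on {0..L}" "\<And>x. x \<in> {0..L} \<Longrightarrow> \<bar>f x\<bar> \<le> g x"
    for f g :: "real \<Rightarrow> real"
    using that by (intro measurable_bounded_by_integrable_imp_absolutely_integrable[of f _ g]
        integrable_imp_measurable) auto
  have v_abs: "v absolutely_integrable_on {0..L}"
    by (rule dominated[OF has_integral_integrable[OF v_int[OF L(2)]] _ v_le])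
      (rule has_integral_integrable[OF has_integral_mult_right[OF integrable_integral[OF k_hk]]])
  define I where "I = integral {0..L} (\<lambda>x. \<bar>v x\<bar>)"
  have v_hk: "(\<lambda>x. \<bar>v x\<bar>) integrable_on {0..L}" using v_abs by (simp add: absolutely_integrable_on_def)
  have u_le: "\<bar>u x\<bar> \<le> I" if x: "x \<in> {0..L}" for x
  proof -
    have sub: "{0..x} \<subseteq> {0..L}" using x by auto
    have "\<bar>u x\<bar> = norm (integral {0..x} v)" using u_eq[OF x] \<open>u 0 = 0\<close> by simp
    also have "\<dots> \<le> integral {0..x} (\<lambda>x. \<bar>v x\<bar>)"
      by (rule Henstock_Kurzweil_Integration.integral_norm_bound_integral)
        (use has_integral_integrable[OF v_int[OF x]] integrable_on_subinterval[OF v_hk sub] in auto)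
    also have "\<dots> \<le> I"
      unfolding I_def by (rule integral_subset_le[OF sub integrable_on_subinterval[OF v_hk sub] v_hk]) simp
    finally show ?thesis .
  qed
  have "I > 0"
  proof -
    obtain x where "x \<in> {0..L}" "u x \<noteq> 0" using assms(6) by auto
    with u_le[of x] show ?thesis by linarith
  qed
  define A where "A = integral {0..L} k"
  have A_eq: "(LINT t:{0..L}|lebesgue. a t powr (- 1 / (p - 1))) = A"
    using set_lebesgue_integral_eq_integral(2)[OF k_int] by (simp add: A_def k_def[abs_def])
  \<comment> \<open>Positivity of \<open>A\<close>: the value 0 would force
    \<open>I \<le> 0\<close>.\<close>
  have "I \<le> integral {0..L} (\<lambda>x. C * k x)"
    unfolding I_def
    by (rule integral_le[OF v_hk _ v_le])
      (rule has_integral_integrable[OF has_integral_mult_right[OF integrable_integral[OF k_hk]]])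
  then have "I \<le> C * A" by (simp add: A_def)
  moreover have "A \<ge> 0" unfolding A_def by (rule Henstock_Kurzweil_Integration.integral_nonneg[OF k_hk k_nonneg])
  ultimately have "A > 0" using \<open>I > 0\<close> by (cases "A = 0") auto

  \<comment> \<open>The primitive of \<rho> and its supremum\<close>
  have \<rho>_abs: "\<rho> absolutely_integrable_on {0..L}"
    using assms(4) by (rule absolutely_integrable_spike_set) (rule negligible_subset[of "{0, L}"], auto)+
  define R where "R x = integral {0..x} \<rho>" for x
  define M where "M = (SUP x\<in>{0..L}. \<bar>LINT t:{0..x}|lebesgue. \<rho> t\<bar>)"
  have \<rho>_hk: "\<rho> integrable_on {0..L}" by (rule set_lebesgue_integral_eq_integral(1)[OF \<rho>_abs])
  have cont_R: "continuous_on {0..L} R"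
    unfolding R_def by (rule indefinite_integral_continuous_1[OF \<rho>_hk])
  have LINT_R: "(LINT t:{0..x}|lebesgue. \<rho> t) = R x" if "x \<in> {0..L}" for x
    unfolding R_def
    by (rule set_lebesgue_integral_eq_integral(2)[OF set_integrable_subset[OF \<rho>_abs]]) (use that in auto)
  have R_le: "\<bar>R x\<bar> \<le> M" if x: "x \<in> {0..L}" for x
  proof -
    have "M = (SUP x\<in>{0..L}. \<bar>R x\<bar>)" unfolding M_def by (rule SUP_cong[OF refl]) (simp add: LINT_R)
    \<comment> \<open>A real supremum bounds its members only if they are bounded above; continuity
      of \<open>R\<close> on a compact interval ensures this.\<close>
    moreover have "bdd_above ((\<lambda>x. \<bar>R x\<bar>) ` {0..L})" using bdd[OF cont_R] by (auto intro: bdd_aboveI2)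
    ultimately show ?thesis using cSUP_upper[OF x] by simp
  qed

  \<comment> \<open>\<open>U\<close> bounds \<open>\<bar>u x\<bar> powr (p - 1)\<close>, the factor
    common to \<open>z\<close> and to the derivative of \<open>\<bar>u\<bar> powr p\<close>.\<close>
  define U where "U = I powr (p - 1)"
  have z_abs: "z absolutely_integrable_on {0..L}"
  proof (rule dominated[OF has_integral_integrable[OF z_int[OF L(2)]]])
    have "(\<lambda>x. \<bar>\<rho> x\<bar>) integrable_on {0..L}" using \<rho>_abs by (simp add: absolutely_integrable_on_def)
    then show "(\<lambda>x. U * \<bar>\<rho> x\<bar>) integrable_on {0..L}"
      by (intro has_integral_integrable[OF has_integral_mult_right[OF integrable_integral]])
    show "\<bar>z x\<bar> \<le> U * \<bar>\<rho> x\<bar>" if x: "x \<in> {0..L}" for x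
    proof (cases "x \<in> N")
      case False
      then have "\<bar>z x\<bar> = \<bar>\<rho> x\<bar> * \<bar>u x\<bar> powr (p - 1)"
        using off_N(5)[of x] x by (metis Diff_iff abs_minus_cancel abs_mult abs_odd_power)
      also have "\<dots> \<le> \<bar>\<rho> x\<bar> * U"
        unfolding U_def using u_le[OF x] \<open>1 < p\<close> by (intro mult_left_mono powr_mono2) auto
      finally show ?thesis by (simp add: mult.commute)
    qed (simp add: z_def U_def)
  qed

  \<comment> \<open>The function \<open>\<bar>u\<bar> powr p\<close> and its derivative\<close>
  define \<phi> where "\<phi> x = \<bar>u x\<bar> powr p" for x
  define \<psi> where "\<psi> x = p * odd_power p (u x) * v x" for x
  have ac_\<phi>: "abs_continuous_on {0..L} \<phi>"
    unfolding \<phi>_def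
    by (rule abs_continuous_on_lipschitz_compose[OF ac_u abs_powr_lipschitz[OF \<open>1 < p\<close> u_le u_le]])
  have \<psi>_int: "(\<psi> has_integral (\<phi> x - \<phi> 0)) {0..x}" if "x \<in> {0..L}" for x
  proof (rule abs_continuous_on_indefinite_integral[OF ac_\<phi> N _ that])
    show "(\<phi> has_real_derivative \<psi> x) (at x)" if "x \<in> {0..L} - N" for x
      unfolding \<phi>_def \<psi>_def by (rule DERIV_chain2[OF DERIV_abs_powr[OF \<open>1 < p\<close>] off_N(2)[OF that]])
  qed
  have \<psi>_le: "\<bar>\<psi> x\<bar> \<le> p * U * \<bar>v x\<bar>" if x: "x \<in> {0..L}" for x
    unfolding \<psi>_def U_def using u_le[OF x] \<open>1 < p\<close>
    by (simp add: abs_mult abs_odd_power) (intro mult_right_mono mult_left_mono powr_mono2, auto)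
  have pUv_int: "((\<lambda>x. p * U * \<bar>v x\<bar>) has_integral (p * U * I)) {0..L}"
    unfolding I_def by (rule has_integral_mult_right[OF integrable_integral[OF v_hk]])
  have \<psi>_abs: "\<psi> absolutely_integrable_on {0..L}"
    by (rule dominated[OF has_integral_integrable[OF \<psi>_int[OF L(2)]] has_integral_integrable[OF pUv_int] \<psi>_le])
  have \<phi>_eq: "\<phi> x = \<phi> 0 + integral {0..x} \<psi>" if "x \<in> {0..L}" for x
    using integral_unique[OF \<psi>_int[OF that]] by simp
  have cont_\<phi>: "continuous_on {0..L} \<phi>"
    by (rule continuous_on_eq[OF _ \<phi>_eq[symmetric]])
      (intro continuous_intros indefinite_integral_continuous_1 has_integral_integrable[OF \<psi>_int[OF L(2)]])

  \<comment> \<open>The energy and its upper bound\<close>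
  define E where "E = integral {0..L} (\<lambda>x. w x * v x)"
  have wv_hk: "(\<lambda>x. w x * v x) integrable_on {0..L}"
    by (rule set_lebesgue_integral_eq_integral(1)[OF absolutely_integrable_continuous_mult[OF cont_w v_abs]])
  have \<phi>\<rho>_hk: "(\<lambda>x. \<phi> x * \<rho> x) integrable_on {0..L}"
    by (rule set_lebesgue_integral_eq_integral(1)[OF absolutely_integrable_continuous_mult[OF cont_\<phi> \<rho>_abs]])
  have R\<psi>_hk: "(\<lambda>x. R x * \<psi> x) integrable_on {0..L}"
    by (rule set_lebesgue_integral_eq_integral(1)[OF absolutely_integrable_continuous_mult[OF cont_R \<psi>_abs]])
  \<comment> \<open>Testing with \<open>u\<close>: the boundary terms vanish with \<open>u 0\<close>
    and \<open>u L\<close>, and off \<open>N\<close> the equation turns \<open>- z x * u x\<close>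
    into \<open>\<phi> x * \<rho> x\<close>.\<close>
  have "((\<lambda>x. v x * w x + u x * z x) has_integral (u L * w L - u 0 * w 0)) {0..L}"
    by (rule has_integral_product_indefinite[OF less_imp_le[OF \<open>0 < L\<close>] v_abs z_abs u_eq w_eq])
  then have "((\<lambda>x. v x * w x + u x * z x) has_integral 0) {0..L}"
    using \<open>u 0 = 0\<close> \<open>u L = 0\<close> by simp
  then have "((\<lambda>x. w x * v x - \<phi> x * \<rho> x) has_integral 0) {0..L}"
  proof (rule has_integral_spike[OF N, rotated])
    fix x assume "x \<in> {0..L} - N"
    then have "\<phi> x * \<rho> x = - z x * u x"
      using odd_power_mult_self[of p "u x"] off_N(5)[of x] by (simp add: \<phi>_def mult.assoc mult.commute)
    then show "w x * v x - \<phi> x * \<rho> x = v x * w x + u x * z x" by (simp add: algebra_simps)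
  qed
  then have E_eq: "E = integral {0..L} (\<lambda>x. \<phi> x * \<rho> x)"
    using Henstock_Kurzweil_Integration.integral_diff[OF wv_hk \<phi>\<rho>_hk] by (simp add: E_def integral_unique)
  \<comment> \<open>Since \<phi> vanishes at both ends, \<rho> is replaced by its primitive, and its
    sign changes enter only through \<open>R\<close>.\<close>
  have "((\<lambda>x. \<rho> x * \<phi> x + R x * \<psi> x) has_integral (R L * \<phi> L - R 0 * \<phi> 0)) {0..L}"
    by (rule has_integral_product_indefinite[OF less_imp_le[OF \<open>0 < L\<close>] \<rho>_abs \<psi>_abs _ \<phi>_eq])
      (simp_all add: R_def)
  then have "((\<lambda>x. \<phi> x * \<rho> x + R x * \<psi> x) has_integral 0) {0..L}"
    using \<open>u 0 = 0\<close> \<open>u L = 0\<close> by (simp add: \<phi>_def mult.commute)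
  then have "E = - integral {0..L} (\<lambda>x. R x * \<psi> x)"
    using Henstock_Kurzweil_Integration.integral_add[OF \<phi>\<rho>_hk R\<psi>_hk] unfolding E_eq
    by (simp add: integral_unique)
  also have "\<dots> \<le> norm (integral {0..L} (\<lambda>x. R x * \<psi> x))" by simp
  also have "\<dots> \<le> integral {0..L} (\<lambda>x. M * (p * U * \<bar>v x\<bar>))"
  proof (rule Henstock_Kurzweil_Integration.integral_norm_bound_integral[OF R\<psi>_hk])
    show "(\<lambda>x. M * (p * U * \<bar>v x\<bar>)) integrable_on {0..L}"
      by (rule has_integral_integrable[OF has_integral_mult_right[OF pUv_int]])
    fix x assume "x \<in> {0..L}"
    then show "norm (R x * \<psi> x) \<le> M * (p * U * \<bar>v x\<bar>)"
      using R_le[of x] \<psi>_le[of x] unfolding real_norm_def abs_mult[of "R x"] by (intro mult_mono) auto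
  qed
  also have "\<dots> = M * (p * U * I)" by (rule integral_unique[OF has_integral_mult_right[OF pUv_int]])
  also have "p * U * I = p * I powr p" using \<open>I > 0\<close> powr_add[of I "p - 1" 1] by (simp add: U_def)
  finally have upper: "E \<le> M * (p * I powr p)" .

  \<comment> \<open>The lower bound of the energy and the conclusion\<close>
  define t where "t = I / A"
  \<comment> \<open>\<open>t\<close> is the mean of \<open>\<bar>v\<bar> / k\<close> for the measure
    \<open>k dx\<close>. With the tangent taken there, the linear term integrates to
    \<open>I - t * A = 0\<close>.\<close>
  have "t > 0" using \<open>I > 0\<close> \<open>A > 0\<close> by (simp add: t_def)
  define T where "T x = t powr p * k x + p * t powr (p - 1) * (\<bar>v x\<bar> - t * k x)" for x
  have T_int: "(T has_integral (t powr p * A + p * t powr (p - 1) * (I - t * A))) {0..L}"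
    unfolding T_def A_def I_def
    by (intro has_integral_add has_integral_diff has_integral_mult_right integrable_integral k_hk v_hk)
  \<comment> \<open>Using \<open>T\<close> itself on \<open>N\<close> makes the comparison hold at
    every point, at no cost to the integral.\<close>
  have "((\<lambda>x. if x \<in> N then T x else w x * v x) has_integral E) {0..L}"
    unfolding E_def by (rule has_integral_spike[OF N _ integrable_integral[OF wv_hk]]) simp
  then have "t powr p * A + p * t powr (p - 1) * (I - t * A) \<le> E"
  proof (rule has_integral_le[OF T_int])
    fix x assume x: "x \<in> {0..L}"
    show "T x \<le> (if x \<in> N then T x else w x * v x)"
    proof (cases "x \<in> N")
      case False
      then have x': "x \<in> {0..L} - N" using x by simp
      have "w x * v x = a x * \<bar>v x\<bar> powr p"
        using off_N(3)[OF x'] odd_power_mult_self[of p "v x"] by (simp add: mult.assoc)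
      with weighted_powr_above_tangent[OF \<open>1 < p\<close> abs_ge_zero[of "v x"] \<open>t > 0\<close> off_N(1)[OF x']] False
      show ?thesis by (simp add: T_def k_def)
    qed simp
  qed
  moreover have "I - t * A = 0" using \<open>A > 0\<close> by (simp add: t_def)
  moreover have "t powr p * A = I powr p * A powr (1 - p)"
    using \<open>I > 0\<close> \<open>A > 0\<close> by (simp add: t_def powr_divide powr_diff)
  ultimately have "I powr p * A powr (1 - p) \<le> E" by simp
  also note upper
  also have "M * (p * I powr p) = I powr p * (p * M)" by (simp only: mult_ac)
  \<comment> \<open>The factor \<open>I powr p\<close> cancels because it is positive, which is
    where nontriviality of \<open>u\<close> enters.\<close>
  finally have "A powr (1 - p) \<le> p * M" using \<open>I > 0\<close> by simp
  then show ?thesis unfolding A_eq M_def[symmetric] using \<open>1 < p\<close> by (simp add: field_simps)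
qed

end
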